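(* Let $r=r(x)$ be an arbitrary positive smooth function and $B=B(x)$ an arbitrary smooth function on an interval, and let $$\mathcal{A}(r)=\frac{(r')^2-2\,r\,r''}{4\,r^2}.$$ Then two linearly independent solutions of the second-order equation $$y''+B\,y'+\frac14\left(4\mathcal{A}(r)+B^2+2B'\right)y=0$$ are given by $$y_j=\sqrt{r}\left(\int\frac{dx}{r}\right)^{j}e^{-\frac12\int B(x)\,dx},\qquad j=0,1.$$
   Context: Here $\int\frac{dx}{r}$ and $\int B(x)\,dx$ denote fixed antiderivatives of $1/r$ and $B$ on the interval, and primes denote derivatives with respect to $x$. *)

theory Defs
  imports "HOL-Analysis.Analysis"
begin

text \<open>Derivatives are taken within the interval \<open>I\<close>, so that intervals of every kind (open,
  half-open, closed, unbounded) are covered, with one-sided derivatives at endpoints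
  belonging to \<open>I\<close>. On a non-degenerate interval this derivative is unique where it exists.\<close>

definition deriv_on :: "real set \<Rightarrow> (real \<Rightarrow> real) \<Rightarrow> real \<Rightarrow> real" where
  "deriv_on I f x = vector_derivative f (at x within I)"

definition smooth_fun_on :: "real set \<Rightarrow> (real \<Rightarrow> real) \<Rightarrow> bool" where
  "smooth_fun_on I f \<longleftrightarrow> (\<forall>n. ((deriv_on I) ^^ n) f differentiable_on I)"

definition antiderivative_on :: "real set \<Rightarrow> (real \<Rightarrow> real) \<Rightarrow> (real \<Rightarrow> real) \<Rightarrow> bool" where
  "antiderivative_on I F f \<longleftrightarrow> (\<forall>x\<in>I. (F has_real_derivative f x) (at x within I))"

definition calA :: "real set \<Rightarrow> (real \<Rightarrow> real) \<Rightarrow> real \<Rightarrow> real" where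
  "calA I r x =
     ((deriv_on I r x)\<^sup>2 - 2 * r x * deriv_on I (deriv_on I r) x) / (4 * (r x)\<^sup>2)"

text \<open>Solutions on \<open>I\<close> of \<open>y'' + p y' + q y = 0\<close>. The differentiability conditions are
  needed because the derivative operator is total.\<close>

definition solves_ode2_on ::
  "real set \<Rightarrow> (real \<Rightarrow> real) \<Rightarrow> (real \<Rightarrow> real) \<Rightarrow> (real \<Rightarrow> real) \<Rightarrow> bool" where
  "solves_ode2_on I p q y \<longleftrightarrow>
     y differentiable_on I \<and> deriv_on I y differentiable_on I \<and>
     (\<forall>x\<in>I. deriv_on I (deriv_on I y) x + p x * deriv_on I y x + q x * y x = 0)"

text \<open>Linear independence over the reals of a family of functions restricted to \<open>I\<close>. The
  library's \<open>independent\<close> concerns sets of vectors, so it does not apply to functions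
  restricted to \<open>I\<close>, and it would not detect two equal members of a family.\<close>

definition lin_indep_on :: "real set \<Rightarrow> nat set \<Rightarrow> (nat \<Rightarrow> real \<Rightarrow> real) \<Rightarrow> bool" where
  "lin_indep_on I J y \<longleftrightarrow>
     (\<forall>c :: nat \<Rightarrow> real. (\<forall>x\<in>I. (\<Sum>j\<in>J. c j * y j x) = 0) \<longrightarrow> (\<forall>j\<in>J. c j = 0))"

end

theory Submission
  imports Defs
begin

text \<open>
  The factor \<open>exp (- P / 2)\<close> with \<open>P' = B\<close> removes the first-order term: \<open>y = v exp (- P / 2)\<close>
  solves \<open>y'' + B y' + (A + B\<^sup>2 / 4 + B' / 2) y = 0\<close> whenever \<open>v'' + A v = 0\<close>
  (\<open>solves_ode2_on_gauge\<close>). The coefficient \<open>A = calA I r\<close> is built so that \<open>u = sqrt r\<close> solves this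
  reduced equation, since \<open>u'' = - A u\<close> (\<open>sqrt_derivatives\<close>). Reduction of order
  then supplies a second solution \<open>u R\<close> with \<open>R' = 1 / u\<^sup>2 = 1 / r\<close> (\<open>reduction_of_order\<close>).
  The quotient of the two solutions is \<open>R\<close>, whose derivative never vanishes, so \<open>R\<close> is not constant
  and the solutions are linearly independent.

  Throughout, \<open>antiderivative_on I f f'\<close> serves to say that \<open>f'\<close> is the derivative of \<open>f\<close>
  within \<open>I\<close>; for a non-degenerate interval this determines \<open>f'\<close> on \<open>I\<close>.
\<close>

section \<open>Derivatives within a non-degenerate interval\<close>

lemma interval_at_within_nontrivial:
  fixes I :: "real set"
  assumes "is_interval I" and "\<exists>a\<in>I. \<exists>b\<in>I. a < b"
  shows "\<forall>x\<in>I. at x within I \<noteq> bot"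
proof
  fix x assume "x \<in> I"
  have "\<not> (\<exists>a. I = {a})" using assms(2) by force
  then have "x islimpt I"
    using connected_imp_perfect \<open>x \<in> I\<close> assms(1) is_interval_connected by blast
  then show "at x within I \<noteq> bot" by (simp add: trivial_limit_within)
qed

lemma deriv_on_eqI:
  assumes "\<forall>x\<in>I. at x within I \<noteq> bot" and "antiderivative_on I f f'" and "x \<in> I"
  shows "deriv_on I f x = f' x"
  using assms unfolding deriv_on_def antiderivative_on_def
  by (intro vector_derivative_within)
     (auto simp: has_real_derivative_iff_has_vector_derivative)

lemma differentiable_on_iff_antiderivative_on:
  "f differentiable_on I \<longleftrightarrow> (\<exists>f'. antiderivative_on I f f')"
  unfolding differentiable_on_def antiderivative_on_def real_differentiable_def
  by metis

lemma antiderivative_on_deriv_on: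
  assumes "\<forall>x\<in>I. at x within I \<noteq> bot" and "f differentiable_on I"
  shows "antiderivative_on I f (deriv_on I f)"
proof -
  obtain f' where f': "antiderivative_on I f f'"
    using assms(2) differentiable_on_iff_antiderivative_on by blast
  show ?thesis
    using f' deriv_on_eqI[OF assms(1) f'] by (simp add: antiderivative_on_def)
qed

lemma antiderivative_on_cong:
  assumes "antiderivative_on I f f'" and "\<And>x. x \<in> I \<Longrightarrow> f x = g x"
    and "\<And>x. x \<in> I \<Longrightarrow> f' x = g' x"
  shows "antiderivative_on I g g'"
  unfolding antiderivative_on_def
proof
  fix x assume x: "x \<in> I"
  then have "(f has_real_derivative g' x) (at x within I)"
    using assms(1,3) by (auto simp: antiderivative_on_def)
  then show "(g has_real_derivative g' x) (at x within I)"
    by (rule has_field_derivative_transform_within[OF _ zero_less_one x]) (use assms(2) in auto)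
qed

lemma smooth_fun_on_antiderivatives:
  assumes "\<forall>x\<in>I. at x within I \<noteq> bot" and "smooth_fun_on I f"
  shows "antiderivative_on I f (deriv_on I f)"
    and "antiderivative_on I (deriv_on I f) (deriv_on I (deriv_on I f))"
proof -
  have *: "((deriv_on I) ^^ n) f differentiable_on I" for n
    using assms(2) by (simp add: smooth_fun_on_def)
  show "antiderivative_on I f (deriv_on I f)"
    using antiderivative_on_deriv_on[OF assms(1) *[of 0]] by simp
  show "antiderivative_on I (deriv_on I f) (deriv_on I (deriv_on I f))"
    using antiderivative_on_deriv_on[OF assms(1) *[of 1]] by simp
qed

lemma solves_ode2_onI:
  assumes nt: "\<forall>x\<in>I. at x within I \<noteq> bot"
    and y: "antiderivative_on I y y'" and y': "antiderivative_on I y' y''"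
    and eq: "\<And>x. x \<in> I \<Longrightarrow> y'' x + p x * y' x + q x * y x = 0"
  shows "solves_ode2_on I p q y"
proof -
  have d1: "deriv_on I y x = y' x" if "x \<in> I" for x
    using deriv_on_eqI[OF nt y that] .
  then have a2: "antiderivative_on I (deriv_on I y) y''"
    by (intro antiderivative_on_cong[OF y']) auto
  have d2: "deriv_on I (deriv_on I y) x = y'' x" if "x \<in> I" for x
    using deriv_on_eqI[OF nt a2 that] .
  show ?thesis
    unfolding solves_ode2_on_def differentiable_on_iff_antiderivative_on
    using y a2 d1 d2 eq by auto
qed

section \<open>Reduction to normal form, and its solutions\<close>

text \<open>With \<open>E = exp (- P / 2)\<close> one has \<open>E' = - (B / 2) E\<close>, so differentiating
  \<open>y = v E\<close> twice produces the term \<open>- B v' E\<close>, which cancels against the one from \<open>B y'\<close>.\<close>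

lemma solves_ode2_on_gauge:
  assumes nt: "\<forall>x\<in>I. at x within I \<noteq> bot"
    and P: "antiderivative_on I P B" and B: "antiderivative_on I B B'"
    and v: "antiderivative_on I v v'" and v': "antiderivative_on I v' (\<lambda>x. - A x * v x)"
    and q: "\<And>x. x \<in> I \<Longrightarrow> q x = A x + (B x)\<^sup>2 / 4 + B' x / 2"
  shows "solves_ode2_on I B q (\<lambda>x. v x * exp (- (1 / 2) * P x))"
proof -
  define E where "E = (\<lambda>x. exp (- (1 / 2) * P x))"
  have E: "(E has_real_derivative - (1 / 2) * B x * E x) (at x within I)" if "x \<in> I" for x
    using P that unfolding E_def antiderivative_on_def
    by (auto intro!: derivative_eq_intros)
  define y' where "y' = (\<lambda>x. (v' x - B x / 2 * v x) * E x)"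
  define y'' where
    "y'' = (\<lambda>x. (- A x * v x - B x * v' x + ((B x)\<^sup>2 / 4 - B' x / 2) * v x) * E x)"
  have "solves_ode2_on I B q (\<lambda>x. v x * E x)"
  proof (rule solves_ode2_onI[OF nt])
    show "antiderivative_on I (\<lambda>x. v x * E x) y'"
      using v E unfolding antiderivative_on_def y'_def
      by (auto intro!: derivative_eq_intros simp: algebra_simps)
    show "antiderivative_on I y' y''"
      using v v' B E unfolding antiderivative_on_def y'_def y''_def
      by (auto intro!: derivative_eq_intros simp: field_simps power2_eq_square)
    show "y'' x + B x * y' x + q x * (v x * E x) = 0" if "x \<in> I" for x
      unfolding y'_def y''_def q[OF that] by (simp add: field_simps power2_eq_square)
  qed
  then show ?thesis by (simp add: E_def)
qed

text \<open>Read backwards, the second identity is where \<open>calA\<close> comes from: it is the potential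
  \<open>- u'' / u\<close> for \<open>u = sqrt r\<close>.\<close>

lemma sqrt_derivatives:
  assumes nt: "\<forall>x\<in>I. at x within I \<noteq> bot"
    and r: "smooth_fun_on I r" and pos: "\<And>x. x \<in> I \<Longrightarrow> 0 < r x"
  shows "antiderivative_on I (\<lambda>x. sqrt (r x)) (\<lambda>x. deriv_on I r x / (2 * sqrt (r x)))"
    and "antiderivative_on I (\<lambda>x. deriv_on I r x / (2 * sqrt (r x)))
           (\<lambda>x. - calA I r x * sqrt (r x))"
proof -
  note d = smooth_fun_on_antiderivatives[OF nt r, unfolded antiderivative_on_def, rule_format]
  have s: "((\<lambda>x. sqrt (r x)) has_real_derivative deriv_on I r x / (2 * sqrt (r x)))
      (at x within I)" if "x \<in> I" for x
    using d(1)[OF that] pos[OF that] by (auto intro!: derivative_eq_intros simp: field_simps)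
  then show "antiderivative_on I (\<lambda>x. sqrt (r x)) (\<lambda>x. deriv_on I r x / (2 * sqrt (r x)))"
    by (simp add: antiderivative_on_def)
  show "antiderivative_on I (\<lambda>x. deriv_on I r x / (2 * sqrt (r x)))
           (\<lambda>x. - calA I r x * sqrt (r x))"
    unfolding antiderivative_on_def
  proof
    fix x assume x: "x \<in> I"
    define u where "u = sqrt (r x)"
    have u: "u > 0" "r x = u\<^sup>2" using pos[OF x] by (auto simp: u_def)
    show "((\<lambda>x. deriv_on I r x / (2 * sqrt (r x))) has_real_derivative
        - calA I r x * sqrt (r x)) (at x within I)"
      using u(1)
      by (auto intro!: derivative_eq_intros d[OF x]
               simp flip: u_def simp: calA_def u(2) field_simps power2_eq_square)
  qed
qed

text \<open>In \<open>(u R)' = u' R + u R'\<close> the choice \<open>R' = 1 / u\<^sup>2\<close> turns the second summand into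
  \<open>1 / u\<close>, whose derivative \<open>- u' / u\<^sup>2\<close> cancels \<open>u' R'\<close>; thus \<open>(u R)'' = u'' R\<close>.\<close>

lemma reduction_of_order:
  assumes u: "antiderivative_on I u u'" and u': "antiderivative_on I u' (\<lambda>x. - A x * u x)"
    and R: "antiderivative_on I R (\<lambda>x. 1 / (u x)\<^sup>2)" and nz: "\<And>x. x \<in> I \<Longrightarrow> u x \<noteq> 0"
  shows "antiderivative_on I (\<lambda>x. u x * R x) (\<lambda>x. u' x * R x + 1 / u x)"
    and "antiderivative_on I (\<lambda>x. u' x * R x + 1 / u x) (\<lambda>x. - A x * (u x * R x))"
  using u u' R nz unfolding antiderivative_on_def
  by (auto intro!: derivative_eq_intros simp: field_simps power2_eq_square)

section \<open>The two solutions\<close>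

text \<open>A vanishing combination forces \<open>c\<^sub>0 + c\<^sub>1 R = 0\<close> after cancelling the common factor, and
  differentiating this leaves \<open>c\<^sub>1 R' = 0\<close>.\<close>

lemma lin_indep_on_quotient:
  assumes nt: "\<forall>x\<in>I. at x within I \<noteq> bot" and ne: "a \<in> I"
    and R: "antiderivative_on I R R'" and R': "R' a \<noteq> 0"
    and w: "\<And>x. x \<in> I \<Longrightarrow> w x \<noteq> 0"
    and y: "\<And>x. x \<in> I \<Longrightarrow> y 0 x = w x" "\<And>x. x \<in> I \<Longrightarrow> y 1 x = w x * R x"
  shows "lin_indep_on I {0, 1} y"
  unfolding lin_indep_on_def
proof (intro allI impI)
  fix c :: "nat \<Rightarrow> real"
  assume c: "\<forall>x\<in>I. (\<Sum>j\<in>{0, 1}. c j * y j x) = 0"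
  have z: "c 0 + c 1 * R x = 0" if "x \<in> I" for x
  proof -
    have "w x * (c 0 + c 1 * R x) = 0"
      using c[rule_format, OF that] y[OF that] by (simp add: algebra_simps)
    then show ?thesis using w[OF that] by simp
  qed
  have "antiderivative_on I (\<lambda>x. c 0 + c 1 * R x) (\<lambda>x. c 1 * R' x)"
    using R unfolding antiderivative_on_def by (auto intro!: derivative_eq_intros)
  then have "antiderivative_on I (\<lambda>x. 0) (\<lambda>x. c 1 * R' x)"
    by (rule antiderivative_on_cong) (use z in auto)
  moreover have "antiderivative_on I (\<lambda>x. 0) (\<lambda>x. 0)"
    by (simp add: antiderivative_on_def)
  ultimately have "c 1 * R' a = 0"
    using deriv_on_eqI[OF nt _ ne] by metis
  then have "c 1 = 0" using R' by simp
  then show "\<forall>j\<in>{0, 1}. c j = 0" using z[OF ne] by auto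
qed

theorem mainTheorem6:
  fixes I :: "real set" and r B R P :: "real \<Rightarrow> real" and y :: "nat \<Rightarrow> real \<Rightarrow> real"
  assumes "is_interval I" and "\<exists>a\<in>I. \<exists>b\<in>I. a < b"
    and "smooth_fun_on I r" and "\<And>x. x \<in> I \<Longrightarrow> 0 < r x"
    and "smooth_fun_on I B"
    and "antiderivative_on I R (\<lambda>x. 1 / r x)"
    and "antiderivative_on I P B"
    and "\<And>j x. y j x = sqrt (r x) * R x ^ j * exp (- (1 / 2) * P x)"
  shows "(\<forall>j\<in>{0, 1}. solves_ode2_on I B
            (\<lambda>x. 1 / 4 * (4 * calA I r x + (B x)\<^sup>2 + 2 * deriv_on I B x)) (y j))
         \<and> lin_indep_on I {0, 1} y"
proof -
  let ?q = "\<lambda>x. 1 / 4 * (4 * calA I r x + (B x)\<^sup>2 + 2 * deriv_on I B x)"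
  note nt = interval_at_within_nontrivial[OF assms(1,2)]
  note pos = assms(4)
  note u = sqrt_derivatives[OF nt assms(3) pos]
  note gauge = solves_ode2_on_gauge[OF nt assms(7)
      smooth_fun_on_antiderivatives(1)[OF nt assms(5)], where A = "calA I r" and q = ?q]
  have R: "antiderivative_on I R (\<lambda>x. 1 / (sqrt (r x))\<^sup>2)"
    using pos by (intro antiderivative_on_cong[OF assms(6)]) (auto simp: less_imp_le)
  have nz: "sqrt (r x) \<noteq> 0" if "x \<in> I" for x
    using pos[OF that] by simp
  have y0: "y 0 = (\<lambda>x. sqrt (r x) * exp (- (1 / 2) * P x))"
    and y1: "y 1 = (\<lambda>x. sqrt (r x) * R x * exp (- (1 / 2) * P x))"
    by (simp_all add: fun_eq_iff assms(8))
  have "solves_ode2_on I B ?q (y 0)"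
    unfolding y0 by (rule gauge[OF u]) (auto simp: field_simps)
  moreover have "solves_ode2_on I B ?q (y 1)"
    unfolding y1 by (rule gauge[OF reduction_of_order[OF u R nz]]) (auto simp: field_simps)
  moreover obtain a where a: "a \<in> I" using assms(2) by blast
  have "lin_indep_on I {0, 1} y"
    by (rule lin_indep_on_quotient[OF nt a assms(6),
          where w = "\<lambda>x. sqrt (r x) * exp (- (1 / 2) * P x)"])
       (use pos[OF a] nz in \<open>auto simp: assms(8)\<close>)
  ultimately show ?thesis by blast
qed

end
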